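(* Let $\Phi=(\Phi^+,\Phi^-)$ be a regular integral structure type, let $\mathscr{V}$ be the operator on regular integral structure types defined below, and let $\vartheta$ be the operator on $\mathbb{Z}[\![z]\!]$ given by $\vartheta\left(\sum_{n\ge0}a_nz^n\right)=-\sum_{n\ge1}a_{n+1}z^n$. Then $(\mathscr{V}\Phi)(z)=\vartheta(\Phi(z))\in\mathbb{Z}[\![z]\!]$.
   Context: $\mathfrak{Fin}_0$ is the category of finite sets and bijections. A structure type is a functor $F:\mathfrak{Fin}_0\to\mathfrak{Fin}$; $F_n=|F(S)|$ for $|S|=n$, and its generating series is $F(z)=\sum_n \frac{F_n}{n!}z^n$. $F$ has degree $n$ if $F(S)=\varnothing$ whenever $|S|\ne n$; every $F$ is the sum of its degree-$n$ components $F_{(n)}$ (with $F_{(n)}(S)=F(S)$ if $|S|=n$, empty otherwise). For $|S|=n$ the symmetric group $\mathcal{S}_n$ acts on $F(S)$ by relabeling; $F$ is regular if every element of every $F(S)$ has trivial stabilizer. An integral structure type is a pair $\Phi=(\Phi^+,\Phi^-)$ of structure types, with generating series $\Phi(z)=\Phi^+(z)-\Phi^-(z)$, sum componentwise; it is regular if $\Phi^+$ and $\Phi^-$ are regular. For a regular structure type $F$ the operator $\mathscr{X}$ is defined by $\mathscr{X}F(S)=F_{(n)}(S\sqcup\{\star\})/\mathbb{Z}_n$ for $|S|=n-1$, where $\mathbb{Z}_n$ is the subgroup of cyclic permutations of the symmetric group on the $n$-element set $S\sqcup\{\star\}$ (for regular $F$ this is again a structure type; e.g. $\mathscr{X}Z^n\cong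 Z^{n-1}$ where $Z^n$ is the structure of linear orderings of an $n$-element set). For a regular integral structure type $\Phi_{(k)}=(\Phi^+_{(k)},\Phi^-_{(k)})$ of degree $k$, $\mathscr{V}\Phi_{(k)}=(\mathbf{0},\mathbf{0})$ for $k=0,1$ and $\mathscr{V}\Phi_{(k)}=(\mathscr{X}\Phi^-_{(k)},\mathscr{X}\Phi^+_{(k)})$ otherwise; $\mathscr{V}$ is extended additively over the decomposition of $\Phi$ into degree components. Here $\mathbf{0}$ is the structure type with $\mathbf{0}(S)=\varnothing$ for all $S$. *)

theory Defs
  imports
    "HOL-Combinatorics.Orbits"
    "HOL-Computational_Algebra.Formal_Power_Series"
begin

section \<open>Structure types\<close>

text \<open>
  The category of finite sets and bijections is represented by its equivalent full subcategory
  of finite sets of natural numbers.  A morphism \<open>S \<rightarrow> T\<close> is a function \<open>\<sigma>\<close> with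
  \<open>inj_on \<sigma> S\<close> and \<open>\<sigma> ` S = T\<close>, considered only up to its values on \<open>S\<close>;
  \<open>relabel F S \<sigma>\<close> is the map \<open>F(\<sigma>) : F(S) \<rightarrow> F(\<sigma> ` S)\<close>.
\<close>

record 'a structure_data =
  structures :: "nat set \<Rightarrow> 'a set"
  relabel :: "nat set \<Rightarrow> (nat \<Rightarrow> nat) \<Rightarrow> 'a \<Rightarrow> 'a"

locale structure_type =
  fixes F :: "'a structure_data"
  assumes finite_structures: "finite S \<Longrightarrow> finite (structures F S)"
    and relabel_in:
      "\<lbrakk>finite S; inj_on \<sigma> S; x \<in> structures F S\<rbrakk> \<Longrightarrow> relabel F S \<sigma> x \<in> structures F (\<sigma> ` S)"
    and relabel_cong:
      "\<lbrakk>finite S; inj_on \<sigma> S; x \<in> structures F S; \<forall>s\<in>S. \<sigma> s = \<tau> s\<rbrakk>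
        \<Longrightarrow> relabel F S \<sigma> x = relabel F S \<tau> x"
    and relabel_id: "\<lbrakk>finite S; x \<in> structures F S\<rbrakk> \<Longrightarrow> relabel F S id x = x"
    and relabel_comp:
      "\<lbrakk>finite S; inj_on \<sigma> S; inj_on \<tau> (\<sigma> ` S); x \<in> structures F S\<rbrakk>
        \<Longrightarrow> relabel F (\<sigma> ` S) \<tau> (relabel F S \<sigma> x) = relabel F S (\<tau> \<circ> \<sigma>) x"

locale regular_structure_type = structure_type F for F :: "'a structure_data" +
  assumes trivial_stabilizer:
    "\<lbrakk>finite S; x \<in> structures F S; \<sigma> permutes S; relabel F S \<sigma> x = x\<rbrakk> \<Longrightarrow> \<sigma> = id"

definition generating_series :: "'a structure_data \<Rightarrow> rat fps" where
  "generating_series F = Abs_fps (\<lambda>n. of_nat (card (structures F {..<n})) / fact n)"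

definition zero_structure :: "'a structure_data" where
  "zero_structure = \<lparr>structures = (\<lambda>S. {}), relabel = (\<lambda>S \<sigma> x. x)\<rparr>"

definition degree_part :: "nat \<Rightarrow> 'a structure_data \<Rightarrow> 'a structure_data" where
  "degree_part n F =
    \<lparr>structures = (\<lambda>S. if card S = n then structures F S else {}), relabel = relabel F\<rparr>"

definition sum_structure :: "(nat \<Rightarrow> 'a structure_data) \<Rightarrow> (nat \<times> 'a) structure_data" where
  "sum_structure G =
    \<lparr>structures = (\<lambda>S. SIGMA k:UNIV. structures (G k) S),
     relabel = (\<lambda>S \<sigma> (k, x). (k, relabel (G k) S \<sigma> x))\<rparr>"

section \<open>The quotient operator\<close>

text \<open>\<open>S \<squnion> {\<star>}\<close> and \<open>\<sigma> \<squnion> id\<close>, with \<open>\<star> = 0\<close> and \<open>S\<close> embedded by \<open>Suc\<close>.\<close>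

definition add_point :: "nat set \<Rightarrow> nat set" where
  "add_point S = insert 0 (Suc ` S)"

definition add_point_map :: "(nat \<Rightarrow> nat) \<Rightarrow> nat \<Rightarrow> nat" where
  "add_point_map \<sigma> = case_nat 0 (Suc \<circ> \<sigma>)"

text \<open>
  A subgroup of cyclic permutations of an unordered \<open>n\<close>-element set \<open>U\<close> is the group generated
  by an \<open>n\<close>-cycle on \<open>U\<close>; \<open>c\<close> chooses such an \<open>n\<close>-cycle for every \<open>U\<close>.
\<close>

definition cycle_choice :: "(nat set \<Rightarrow> nat \<Rightarrow> nat) \<Rightarrow> bool" where
  "cycle_choice c \<longleftrightarrow> (\<forall>U. finite U \<and> U \<noteq> {} \<longrightarrow> c U permutes U \<and> cyclic_on (c U) U)"

definition cyc_orbit ::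
    "(nat set \<Rightarrow> nat \<Rightarrow> nat) \<Rightarrow> 'a structure_data \<Rightarrow> nat set \<Rightarrow> 'a \<Rightarrow> 'a set" where
  "cyc_orbit c F U x = {relabel F U (c U ^^ i) x | i. True}"

text \<open>
  The chosen cyclic subgroups are in general not stable under conjugation by bijections \<open>\<sigma> \<squnion> id\<close>, so
  relabelling does not map orbits to orbits.  For regular \<open>F\<close> one can however choose, stably under
  all \<open>\<sigma> \<squnion> id\<close>, exactly one representative in each orbit
  (for linear orders: those with \<open>\<star>\<close> in first place), and relabel orbits through their
  representatives.  Only the action on morphisms depends on this choice.
\<close>

definition orbit_section ::
    "(nat set \<Rightarrow> nat \<Rightarrow> nat) \<Rightarrow> 'a structure_data \<Rightarrow> (nat set \<Rightarrow> 'a set) \<Rightarrow> bool" where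
  "orbit_section c F R \<longleftrightarrow>
    (\<forall>S. finite S \<longrightarrow>
      R S \<subseteq> structures F (add_point S) \<and>
      (\<forall>x \<in> structures F (add_point S). \<exists>!r. r \<in> R S \<and> r \<in> cyc_orbit c F (add_point S) x) \<and>
      (\<forall>\<sigma>. inj_on \<sigma> S \<longrightarrow>
        (\<forall>r \<in> R S. relabel F (add_point S) (add_point_map \<sigma>) r \<in> R (\<sigma> ` S))))"

definition X_op :: "(nat set \<Rightarrow> nat \<Rightarrow> nat) \<Rightarrow> 'a structure_data \<Rightarrow> 'a set structure_data" where
  "X_op c F =
    (let R = (SOME R. orbit_section c F R) in
      \<lparr>structures = (\<lambda>S. cyc_orbit c F (add_point S) `
          structures (degree_part (card S + 1) F) (add_point S)),
       relabel = (\<lambda>S \<sigma> B. cyc_orbit c F (add_point (\<sigma> ` S))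
          (relabel F (add_point S) (add_point_map \<sigma>) (THE r. r \<in> R S \<and> r \<in> B)))\<rparr>)"

section \<open>Integral structure types\<close>

text \<open>
  The positive and the negative part may take values in different types.
\<close>

type_synonym ('a, 'b) integral_data = "'a structure_data \<times> 'b structure_data"

definition regular_integral :: "('a, 'b) integral_data \<Rightarrow> bool" where
  "regular_integral \<Phi> \<longleftrightarrow>
    regular_structure_type (fst \<Phi>) \<and> regular_structure_type (snd \<Phi>)"

definition integral_series :: "('a, 'b) integral_data \<Rightarrow> rat fps" where
  "integral_series \<Phi> = generating_series (fst \<Phi>) - generating_series (snd \<Phi>)"

definition integral_degree_part :: "nat \<Rightarrow> ('a, 'b) integral_data \<Rightarrow> ('a, 'b) integral_data" where
  "integral_degree_part k \<Phi> = (degree_part k (fst \<Phi>), degree_part k (snd \<Phi>))"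

definition integral_sum ::
    "(nat \<Rightarrow> ('a, 'b) integral_data) \<Rightarrow> (nat \<times> 'a, nat \<times> 'b) integral_data" where
  "integral_sum \<Psi> = (sum_structure (\<lambda>k. fst (\<Psi> k)), sum_structure (\<lambda>k. snd (\<Psi> k)))"

definition V_homogeneous :: "(nat set \<Rightarrow> nat \<Rightarrow> nat) \<Rightarrow> nat \<Rightarrow>
    ('a, 'b) integral_data \<Rightarrow> ('b set, 'a set) integral_data" where
  "V_homogeneous c k \<Phi> =
    (if k = 0 \<or> k = 1 then (zero_structure, zero_structure)
     else (X_op c (snd \<Phi>), X_op c (fst \<Phi>)))"

definition V_op :: "(nat set \<Rightarrow> nat \<Rightarrow> nat) \<Rightarrow>
    ('a, 'b) integral_data \<Rightarrow> (nat \<times> 'b set, nat \<times> 'a set) integral_data" where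
  "V_op c \<Phi> = integral_sum (\<lambda>k. V_homogeneous c k (integral_degree_part k \<Phi>))"

definition vartheta :: "int fps \<Rightarrow> int fps" where
  "vartheta a = - Abs_fps (\<lambda>n. if n \<ge> 1 then fps_nth a (n + 1) else 0)"

text \<open>The inclusion of the integral into the rational power series.\<close>

definition fps_of_int_fps :: "int fps \<Rightarrow> rat fps" where
  "fps_of_int_fps a = Abs_fps (\<lambda>n. of_int (fps_nth a n))"

section \<open>Well-definedness\<close>

lemma (in structure_type) card_structures:
  assumes S: "finite S"
  shows "card (structures F S) = card (structures F {..<card S})"
proof -
  have le: "card (structures F A) \<le> card (structures F B)"
    if A: "finite A" and h: "bij_betw h A B" for A B and h :: "nat \<Rightarrow> nat"
  proof (rule card_inj_on_le)
    have inj: "inj_on h A" and im: "h ` A = B" using h by (auto simp: bij_betw_def)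
    show "finite (structures F B)" using A im finite_structures by blast
    show "relabel F A h ` structures F A \<subseteq> structures F B"
      using relabel_in[OF A inj] im by blast
    let ?k = "the_inv_into A h"
    have "relabel F B ?k (relabel F A h x) = x" if x: "x \<in> structures F A" for x
    proof -
      have "relabel F B ?k (relabel F A h x) = relabel F A (?k \<circ> h) x"
        using relabel_comp[OF A inj _ x, of ?k] im inj_on_the_inv_into[OF inj] by simp
      also have "\<dots> = relabel F A id x"
        using inj by (intro relabel_cong[OF A _ x]) (auto simp: inj_on_def the_inv_into_f_f)
      finally show ?thesis using relabel_id[OF A x] by simp
    qed
    then show "inj_on (relabel F A h) (structures F A)" by (rule inj_on_inverseI)
  qed
  obtain h where h: "bij_betw h {..<card S} S"
    using ex_bij_betw_nat_finite[OF S] by (auto simp: atLeast0LessThan)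
  show ?thesis using le[OF _ h] le[OF S bij_betw_the_inv_into[OF h]] by simp
qed

lemma cycle_choice_exists: "\<exists>c. cycle_choice c"
proof -
  have "\<exists>f. f permutes U \<and> cyclic_on f U" if U: "finite U" "U \<noteq> {}" for U :: "nat set"
  proof -
    let ?n = "card U" and ?s = "\<lambda>i. Suc i mod card U"
    have n: "0 < ?n" using U by (simp add: card_gt_0_iff)
    obtain h where h: "bij_betw h {..<?n} U"
      using ex_bij_betw_nat_finite[OF U(1)] by (auto simp: atLeast0LessThan)
    have pow: "(?s ^^ k) 0 = k mod ?n" for k
      by (induction k) (simp_all add: mod_Suc_eq)
    have "orbit ?s 0 = {..<?n}"
    proof (intro equalityI subsetI)
      fix j assume "j \<in> {..<?n}"
      then have "j = (?s ^^ (j + ?n)) 0" unfolding pow by simp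
      then show "j \<in> orbit ?s 0" unfolding orbit_altdef using n by (intro CollectI exI[of _ "j + ?n"]) simp
    qed (use n in \<open>auto simp: orbit_altdef pow\<close>)
    then have cyc: "cyclic_on ?s {..<?n}" using n unfolding cyclic_on_def by (intro bexI[of _ 0]) auto
    define f where "f u = (if u \<in> U then h (?s (the_inv_into {..<?n} h u)) else u)" for u
    have "f (h i) = h (?s i)" if "i \<in> {..<?n}" for i
      using that h by (auto simp: f_def bij_betw_def the_inv_into_f_f)
    then have fcyc: "cyclic_on f U"
      using cyclic_on_image[OF cyc, of f h] h by (simp add: bij_betw_def)
    have sub: "f ` U \<subseteq> U" using cyclic_on_inI[OF fcyc] by blast
    have "U \<subseteq> f ` U"
    proof
      fix u assume "u \<in> U"
      then have "u \<in> orbit f u" using fcyc by (auto simp: cyclic_on_alldef)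
      then show "u \<in> f ` U"
      proof cases
        case base then show ?thesis using \<open>u \<in> U\<close> by blast
      next
        case (step y)
        then have "y \<in> U" using fcyc \<open>u \<in> U\<close> by (auto simp: cyclic_on_alldef)
        then show ?thesis using step by blast
      qed
    qed
    then have "bij_betw f U U" using sub U by (metis bij_betw_def finite_surj_inj subset_antisym)
    then have "f permutes U" by (rule bij_imp_permutes) (simp add: f_def)
    then show ?thesis using fcyc by blast
  qed
  then have "\<forall>U. \<exists>f. finite U \<and> U \<noteq> {} \<longrightarrow> f permutes U \<and> cyclic_on f (U :: nat set)" by blast
  then show ?thesis unfolding cycle_choice_def by (rule choice)
qed

lemma finite_add_point [simp]: "finite S \<Longrightarrow> finite (add_point S)"
  by (simp add: add_point_def)

lemma add_point_ne [simp]: "add_point S \<noteq> {}"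
  by (simp add: add_point_def)

lemma zero_in_add_point [simp]: "0 \<in> add_point S"
  by (simp add: add_point_def)

lemma card_add_point: "finite S \<Longrightarrow> card (add_point S) = card S + 1"
  by (simp add: add_point_def card_image card_insert_if image_iff)

lemma add_point_map_0 [simp]: "add_point_map \<sigma> 0 = 0"
  and add_point_map_Suc [simp]: "add_point_map \<sigma> (Suc n) = Suc (\<sigma> n)"
  by (simp_all add: add_point_map_def)

lemma add_point_map_image: "add_point_map \<sigma> ` add_point S = add_point (\<sigma> ` S)"
  by (auto simp: add_point_def image_iff)

lemma inj_on_add_point_map: "inj_on \<sigma> S \<Longrightarrow> inj_on (add_point_map \<sigma>) (add_point S)"
  by (auto simp: add_point_def inj_on_def)

lemma add_point_map_id [simp]: "add_point_map id = id"
  by (rule ext) (simp add: add_point_map_def split: nat.split)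

lemma add_point_map_comp: "add_point_map \<tau> \<circ> add_point_map \<sigma> = add_point_map (\<tau> \<circ> \<sigma>)"
  by (rule ext) (simp add: add_point_map_def split: nat.split)

lemma add_point_map_permutes:
  assumes "\<sigma> permutes S"
  shows "add_point_map \<sigma> permutes add_point S"
proof (rule bij_imp_permutes)
  show "bij_betw (add_point_map \<sigma>) (add_point S) (add_point S)"
    using assms
    by (simp add: bij_betw_def inj_on_add_point_map permutes_inj_on add_point_map_image permutes_image)
  show "add_point_map \<sigma> x = x" if "x \<notin> add_point S" for x
    using that assms by (cases x) (auto simp: add_point_def image_iff permutes_not_in)
qed

lemma add_point_map_eq_idD: "add_point_map \<sigma> = id \<Longrightarrow> \<sigma> = id"
  by (metis add_point_map_Suc eq_id_iff nat.inject)

lemma regular_zero_structure: "regular_structure_type zero_structure"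
  by unfold_locales (auto simp: zero_structure_def)

lemma (in regular_structure_type) regular_degree_part:
  "regular_structure_type (degree_part n F)"
proof unfold_locales
  fix S :: "nat set" and x and \<sigma> :: "nat \<Rightarrow> nat"
  assume "finite S" "inj_on \<sigma> S" "x \<in> structures (degree_part n F) S"
  then show "relabel (degree_part n F) S \<sigma> x \<in> structures (degree_part n F) (\<sigma> ` S)"
    by (auto simp: degree_part_def card_image relabel_in split: if_splits)
qed (auto simp: degree_part_def finite_structures relabel_id relabel_comp
        intro: relabel_cong trivial_stabilizer split: if_splits)

lemma regular_sum_structure:
  assumes reg: "\<And>k. regular_structure_type (G k)"
    and fin: "\<And>S. finite S \<Longrightarrow> finite {k. structures (G k) S \<noteq> {}}"
  shows "regular_structure_type (sum_structure G)"
proof -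
  interpret G: regular_structure_type "G k" for k by (rule reg)
  show ?thesis
  proof unfold_locales
    fix S :: "nat set" assume S: "finite S"
    have "structures (sum_structure G) S =
        (SIGMA k:{k. structures (G k) S \<noteq> {}}. structures (G k) S)"
      by (auto simp: sum_structure_def)
    then show "finite (structures (sum_structure G) S)"
      using fin[OF S] G.finite_structures[OF S] by auto
  qed (auto simp: sum_structure_def G.relabel_id G.relabel_comp
        intro: G.relabel_in G.relabel_cong G.trivial_stabilizer)
qed

lemma orbit_sectionD:
  assumes sec: "orbit_section c F R" and S: "finite S"
  shows "R S \<subseteq> structures F (add_point S)"
    and "x \<in> structures F (add_point S) \<Longrightarrow>
      \<exists>!r. r \<in> R S \<and> r \<in> cyc_orbit c F (add_point S) x"
    and "\<lbrakk>inj_on \<sigma> S; r \<in> R S\<rbrakk> \<Longrightarrow>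
      relabel F (add_point S) (add_point_map \<sigma>) r \<in> R (\<sigma> ` S)"
proof -
  note * = sec[unfolded orbit_section_def, THEN spec, THEN mp, OF S]
  show "R S \<subseteq> structures F (add_point S)" by (rule conjunct1[OF *])
  show "x \<in> structures F (add_point S) \<Longrightarrow>
      \<exists>!r. r \<in> R S \<and> r \<in> cyc_orbit c F (add_point S) x"
    by (rule bspec[OF conjunct1[OF conjunct2[OF *]]])
  show "\<lbrakk>inj_on \<sigma> S; r \<in> R S\<rbrakk> \<Longrightarrow>
      relabel F (add_point S) (add_point_map \<sigma>) r \<in> R (\<sigma> ` S)"
    using conjunct2[OF conjunct2[OF *]] by simp
qed

locale regular_with_cycles = regular_structure_type F
  for F :: "'a structure_data" +
  fixes c :: "nat set \<Rightarrow> nat \<Rightarrow> nat"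
  assumes cycles: "cycle_choice c"
begin

abbreviation "orb \<equiv> cyc_orbit c F"

lemma c_permutes: "finite U \<Longrightarrow> U \<noteq> {} \<Longrightarrow> c U permutes U"
  using cycles by (simp add: cycle_choice_def)

lemma pow_permutes: "finite U \<Longrightarrow> U \<noteq> {} \<Longrightarrow> (c U ^^ i) permutes U"
  by (induction i) (auto simp: c_permutes permutes_id permutes_compose simp flip: id_def)

lemma c_transitive:
  assumes "finite U" "u \<in> U" "v \<in> U"
  obtains i where "(c U ^^ i) u = v"
proof -
  have "cyclic_on (c U) U" using cycles assms unfolding cycle_choice_def by blast
  then have "v \<in> orbit (c U) u" using assms unfolding cyclic_on_alldef by blast
  then show ?thesis using that by (auto simp: orbit_altdef)
qed

lemma pow_fix_imp_id:
  assumes U: "finite U" "u \<in> U" and fixed: "(c U ^^ i) u = u"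
  shows "c U ^^ i = id"
proof
  fix v
  show "(c U ^^ i) v = id v"
  proof (cases "v \<in> U")
    case True
    then obtain j where j: "(c U ^^ j) u = v" using c_transitive[OF U] by blast
    have "(c U ^^ i) v = (c U ^^ (i + j)) u" using j by (simp add: funpow_add)
    also have "\<dots> = (c U ^^ j) ((c U ^^ i) u)" by (subst add.commute) (simp add: funpow_add)
    finally show ?thesis using fixed j by simp
  next
    case False
    moreover have "(c U ^^ i) permutes U" using pow_permutes U by blast
    ultimately show ?thesis by (simp add: permutes_not_in)
  qed
qed

lemma relabel_permutes_comp:
  assumes "finite U" "x \<in> structures F U" "p permutes U" "q permutes U"
  shows "relabel F U q (relabel F U p x) = relabel F U (q \<circ> p) x"
proof -
  have "p ` U = U" using assms(3) by (rule permutes_image)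
  then show ?thesis
    using relabel_comp[of U p q x] assms by (simp add: permutes_inj_on)
qed

lemma relabel_permutes_in:
  assumes "finite U" "x \<in> structures F U" "p permutes U"
  shows "relabel F U p x \<in> structures F U"
  using relabel_in[of U p x] assms by (simp add: permutes_inj_on permutes_image)

lemma orb_self:
  assumes "finite U" "x \<in> structures F U" shows "x \<in> orb U x"
  using relabel_id[OF assms] unfolding cyc_orbit_def by (force intro!: exI[of _ 0])

lemma orb_subset:
  assumes "finite U" "U \<noteq> {}" "x \<in> structures F U" shows "orb U x \<subseteq> structures F U"
  using assms by (auto simp: cyc_orbit_def intro: relabel_permutes_in pow_permutes)

lemma orb_sym:
  assumes U: "finite U" "U \<noteq> {}" and x: "x \<in> structures F U" and y: "y \<in> orb U x"
  shows "x \<in> orb U y"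
proof -
  obtain i where i: "y = relabel F U (c U ^^ i) x" using y by (auto simp: cyc_orbit_def)
  obtain u where u: "u \<in> U" using U by blast
  have iu: "(c U ^^ i) u \<in> U" using permutes_in_image[OF pow_permutes[OF U]] u by blast
  obtain j where j: "(c U ^^ j) ((c U ^^ i) u) = u" using c_transitive[OF U(1) iu u] by blast
  then have "(c U ^^ (j + i)) u = u" by (simp add: funpow_add)
  then have "c U ^^ (j + i) = id" by (rule pow_fix_imp_id[OF U(1) u])
  then have "c U ^^ j \<circ> c U ^^ i = id" by (simp add: funpow_add)
  then have "relabel F U (c U ^^ j) y = x"
    using i relabel_permutes_comp[OF U(1) x pow_permutes[OF U] pow_permutes[OF U]]
      relabel_id[OF U(1) x] by metis
  then show ?thesis unfolding cyc_orbit_def by blast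
qed

lemma orb_trans:
  assumes U: "finite U" "U \<noteq> {}" and x: "x \<in> structures F U" and y: "y \<in> orb U x"
  shows "orb U y \<subseteq> orb U x"
proof -
  obtain i where i: "y = relabel F U (c U ^^ i) x" using y by (auto simp: cyc_orbit_def)
  have "relabel F U (c U ^^ j) y = relabel F U (c U ^^ (j + i)) x" for j
    using i relabel_permutes_comp[OF U(1) x pow_permutes[OF U] pow_permutes[OF U]]
    by (simp add: funpow_add)
  then show ?thesis unfolding cyc_orbit_def by blast
qed

lemma orb_eq:
  assumes "finite U" "U \<noteq> {}" "x \<in> structures F U" "y \<in> orb U x"
  shows "orb U y = orb U x"
  using assms orb_trans orb_sym orb_subset by (meson subset_antisym subsetD)

text \<open>Relabellings of one structure on \<open>B\<close> by two bijections agree only if the bijections do.\<close>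

lemma relabel_inj:
  assumes B: "finite B" "inj_on f B" "inj_on g B" "f ` B = g ` B" "x \<in> structures F B"
    and eq: "relabel F B f x = relabel F B g x" and b: "b \<in> B"
  shows "f b = g b"
proof -
  define p where "p = (\<lambda>b. if b \<in> B then the_inv_into B g (f b) else b)"
  have gp: "g (p b) = f b" if "b \<in> B" for b
    using that B by (metis p_def f_the_inv_into_f imageI)
  have pB: "p b \<in> B" if "b \<in> B" for b
    using that B by (metis p_def the_inv_into_into imageI order_refl)
  have "inj_on p B" using gp B(2) by (metis inj_on_def)
  then have "bij_betw p B B" using pB B(1)
    by (metis bij_betw_def endo_inj_surj image_subsetI)
  then have pp: "p permutes B" by (rule bij_imp_permutes) (simp add: p_def)
  let ?h = "the_inv_into B g"
  have hg: "inj_on ?h (g ` B)" "?h ` g ` B = B"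
    using B by (auto simp: inj_on_the_inv_into the_inv_into_f_f image_image)
  have "relabel F B (?h \<circ> f) x = relabel F B (?h \<circ> g) x"
    using relabel_comp[of B f ?h x] relabel_comp[of B g ?h x] B hg eq by simp
  moreover have "relabel F B (?h \<circ> f) x = relabel F B p x"
    using B hg by (intro relabel_cong) (auto simp: p_def intro!: comp_inj_on)
  moreover have "relabel F B (?h \<circ> g) x = relabel F B id x"
    using B hg by (intro relabel_cong) (auto simp: the_inv_into_f_f intro!: comp_inj_on)
  ultimately have "relabel F B p x = x" using relabel_id B by simp
  then have "p = id" using trivial_stabilizer[OF B(1,5) pp] by blast
  then show ?thesis using gp[OF b] by simp
qed

lemma orbit_section_exists: "\<exists>R. orbit_section c F R"
proof -
  define base where "base n = add_point {..<n}" for n :: nat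
  define same where "same n x y \<longleftrightarrow> (\<exists>p. p permutes base n \<and> y = relabel F (base n) p x)"
    for n x y
  define rep where "rep n x = (SOME y. y \<in> structures F (base n) \<and> same n y x)" for n x
  have fin: "finite (base n)" for n by (simp add: base_def)
  have same_sym: "same n y x" if xy: "same n x y" and x: "x \<in> structures F (base n)" for n x y
  proof -
    obtain p where p: "p permutes base n" "y = relabel F (base n) p x"
      using xy unfolding same_def by blast
    have "relabel F (base n) (inv p) y = x"
      using relabel_permutes_comp[OF fin x p(1) permutes_inv[OF p(1)]] p
        relabel_id[OF fin x] by (simp add: permutes_inv_o)
    then show ?thesis unfolding same_def using permutes_inv[OF p(1)] by blast
  qed
  have same_trans: "same n x z" if "same n x y" "same n y z" "x \<in> structures F (base n)" for n x y z
    using that unfolding same_def by (metis relabel_permutes_comp[OF fin] permutes_compose)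
  have same_in: "y \<in> structures F (base n)" if "same n x y" "x \<in> structures F (base n)" for n x y
    using that relabel_permutes_in[OF fin] unfolding same_def by blast
  have rep: "rep n x \<in> structures F (base n) \<and> same n (rep n x) x"
    if "x \<in> structures F (base n)" for n x
  proof -
    have "same n x x" unfolding same_def using permutes_id relabel_id[OF fin that] by metis
    then have "\<exists>y. y \<in> structures F (base n) \<and> same n y x" using that by blast
    then show ?thesis unfolding rep_def by (rule someI_ex)
  qed
  have rep_eq: "rep n x = rep n y"
    if "same n x y" "x \<in> structures F (base n)" for n x y
  proof -
    have "y \<in> structures F (base n)" using same_in that by blast
    then have "(z \<in> structures F (base n) \<and> same n z x) = (z \<in> structures F (base n) \<and> same n z y)" for z
      using same_trans same_sym that by blast
    then show ?thesis unfolding rep_def by simp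
  qed
  define R where "R S = {relabel F (base (card S)) (add_point_map h) (rep (card S) b) | h b.
      bij_betw h {..<card S} S \<and> b \<in> structures F (base (card S))}" for S
  have h_props: "inj_on (add_point_map h) (base n)" "add_point_map h ` base n = add_point S"
    if "bij_betw h {..<n} S" for h n S
    using that unfolding base_def by (auto simp: bij_betw_def inj_on_add_point_map add_point_map_image)
  have R_sub: "R S \<subseteq> structures F (add_point S)" for S
  proof
    fix r assume "r \<in> R S"
    then obtain h b where h: "bij_betw h {..<card S} S" and b: "b \<in> structures F (base (card S))"
      and r: "r = relabel F (base (card S)) (add_point_map h) (rep (card S) b)"
      unfolding R_def by blast
    show "r \<in> structures F (add_point S)"
      using relabel_in[OF fin h_props(1)[OF h], of "rep (card S) b"] rep[OF b]
      unfolding r h_props(2)[OF h] by blast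
  qed
  have ex: "\<exists>r. r \<in> R S \<and> r \<in> orb (add_point S) x"
    if S: "finite S" and x: "x \<in> structures F (add_point S)" for S x
  proof -
    let ?n = "card S" and ?U = "add_point S"
    have U: "finite ?U" "?U \<noteq> {}" using S by auto
    obtain h where h: "bij_betw h {..<?n} S"
      using ex_bij_betw_nat_finite[OF S] by (auto simp: atLeast0LessThan)
    let ?h = "add_point_map h" and ?k = "the_inv_into (base ?n) (add_point_map h)"
    note hp = h_props[OF h]
    have k: "inj_on ?k ?U" "?k ` ?U = base ?n"
      using hp by (metis inj_on_the_inv_into) (metis hp the_inv_into_onto)
    define y where "y = relabel F ?U ?k x"
    have y: "y \<in> structures F (base ?n)" using relabel_in[OF U(1) k(1) x] k(2) by (simp add: y_def)
    have xy: "relabel F (base ?n) ?h y = x"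
    proof -
      have "relabel F (base ?n) ?h y = relabel F ?U (?h \<circ> ?k) x"
        using relabel_comp[OF U(1) k(1), of ?h x] k(2) hp x by (simp add: y_def)
      also have "\<dots> = relabel F ?U id x"
        using U x k hp by (intro relabel_cong) (auto simp: f_the_inv_into_f intro!: comp_inj_on)
      finally show ?thesis using relabel_id U x by simp
    qed
    obtain p where p: "p permutes base ?n" "y = relabel F (base ?n) p (rep ?n y)"
      and ry: "rep ?n y \<in> structures F (base ?n)"
      using rep[OF y] unfolding same_def by blast
    let ?u = "?h \<circ> p"
    have u: "inj_on ?u (base ?n)" "?u ` base ?n = ?U"
    proof -
      show "inj_on ?u (base ?n)"
        using hp(1) permutes_inj_on[OF p(1)] permutes_image[OF p(1)] by (intro comp_inj_on) simp_all
      show "?u ` base ?n = ?U" using hp(2) permutes_image[OF p(1)] by (metis image_comp)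
    qed
    have xu: "x = relabel F (base ?n) ?u (rep ?n y)"
      using relabel_comp[OF fin permutes_inj_on[OF p(1)] _ ry, of ?h] hp p xy
      by (simp add: permutes_image)
    have "?u 0 \<in> ?U" using u(2) by (metis base_def imageI zero_in_add_point)
    then obtain i where i: "(c ?U ^^ i) (?u 0) = 0" using c_transitive[OF U(1)] zero_in_add_point by metis
    let ?w = "c ?U ^^ i \<circ> ?u"
    have pi: "(c ?U ^^ i) permutes ?U" using pow_permutes U by blast
    have w: "inj_on ?w (base ?n)" "?w ` base ?n = ?U" "?w 0 = 0"
    proof -
      show "inj_on ?w (base ?n)" by (rule comp_inj_on[OF u(1) permutes_inj_on[OF pi]])
      show "?w ` base ?n = ?U" using u(2) permutes_image[OF pi] by (metis image_comp)
    qed (use i in simp)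
    have r: "relabel F ?U (c ?U ^^ i) x = relabel F (base ?n) ?w (rep ?n y)"
      using relabel_comp[OF fin u(1) _ ry, of "c ?U ^^ i"] u(2) xu permutes_inj_on[OF pi] by simp
    define g where "g m = ?w (Suc m) - 1" for m
    have w_pos: "?w (Suc m) \<noteq> 0 \<and> ?w (Suc m) - 1 \<in> S" if "m < ?n" for m
    proof -
      have m: "Suc m \<in> base ?n" "0 \<in> base ?n" using that by (auto simp: base_def add_point_def)
      have ne: "?w (Suc m) \<noteq> 0" using inj_onD[OF w(1) _ m] w(3) by (metis nat.distinct(1))
      have "?w (Suc m) \<in> ?U" using w(2) m by blast
      then show ?thesis using ne by (auto simp: add_point_def)
    qed
    have wg: "?w b = add_point_map g b" if "b \<in> base ?n" for b
    proof (cases b)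
      case 0 then show ?thesis using w(3) by simp
    next
      case (Suc m)
      then have "m < ?n" using that by (auto simp: base_def add_point_def)
      then show ?thesis using w_pos[of m] Suc by (simp add: g_def)
    qed
    have "inj_on g {..<?n}"
    proof (rule inj_onI)
      fix a b assume ab: "a \<in> {..<?n}" "b \<in> {..<?n}" "g a = g b"
      then have "Suc a \<in> base ?n" "Suc b \<in> base ?n" by (auto simp: base_def add_point_def)
      moreover from this have "?w (Suc a) = ?w (Suc b)" using wg ab(3) by simp
      ultimately show "a = b" using inj_onD[OF w(1)] by blast
    qed
    moreover have "g ` {..<?n} \<subseteq> S" using w_pos by (auto simp: g_def)
    ultimately have "bij_betw g {..<?n} S"
      using S by (metis bij_betw_def card_image card_lessThan card_subset_eq)
    moreover have "relabel F (base ?n) ?w (rep ?n y) =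
        relabel F (base ?n) (add_point_map g) (rep ?n y)"
      using wg by (intro relabel_cong[OF fin w(1) ry]) blast
    ultimately have "relabel F ?U (c ?U ^^ i) x \<in> R S" unfolding r R_def using y by blast
    then show ?thesis unfolding cyc_orbit_def by blast
  qed
  have uniq: "r = s" if S: "finite S" and x: "x \<in> structures F (add_point S)"
    and rR: "r \<in> R S" and sR: "s \<in> R S"
    and ro: "r \<in> orb (add_point S) x" and so: "s \<in> orb (add_point S) x" for S x r s
  proof -
    let ?n = "card S" and ?U = "add_point S"
    have U: "finite ?U" "?U \<noteq> {}" using S by auto
    have "s \<in> orb ?U r" using orb_eq[OF U x ro] so by blast
    then obtain i where i: "s = relabel F ?U (c ?U ^^ i) r" by (auto simp: cyc_orbit_def)
    have pi: "(c ?U ^^ i) permutes ?U" using pow_permutes U by blast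
    obtain h b where h: "bij_betw h {..<?n} S" and b: "b \<in> structures F (base ?n)"
      and r: "r = relabel F (base ?n) (add_point_map h) (rep ?n b)"
      using rR unfolding R_def by blast
    obtain k d where k: "bij_betw k {..<?n} S" and d: "d \<in> structures F (base ?n)"
      and s: "s = relabel F (base ?n) (add_point_map k) (rep ?n d)"
      using sR unfolding R_def by blast
    note hp = h_props[OF h] and kp = h_props[OF k]
    note rb = conjunct1[OF rep[OF b]] and rd = conjunct1[OF rep[OF d]]
    let ?v = "c ?U ^^ i \<circ> add_point_map h"
    have v: "inj_on ?v (base ?n)" "?v ` base ?n = ?U"
    proof -
      show "inj_on ?v (base ?n)" by (rule comp_inj_on[OF hp(1) permutes_inj_on[OF pi]])
      show "?v ` base ?n = ?U" using hp(2) permutes_image[OF pi] by (metis image_comp)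
    qed
    have sv: "s = relabel F (base ?n) ?v (rep ?n b)"
      using relabel_comp[OF fin hp(1) _ rb, of "c ?U ^^ i"] hp(2) permutes_inj_on[OF pi] i r by simp
    let ?l = "the_inv_into (base ?n) (add_point_map k)"
    have l: "inj_on ?l ?U" "?l ` ?U = base ?n"
      using kp by (metis inj_on_the_inv_into) (metis kp the_inv_into_onto)
    have "relabel F ?U ?l s = relabel F (base ?n) (?l \<circ> add_point_map k) (rep ?n d)"
      using relabel_comp[OF fin kp(1) _ rd, of ?l] kp l s by simp
    also have "\<dots> = relabel F (base ?n) id (rep ?n d)"
      using kp l by (intro relabel_cong[OF fin _ rd]) (auto simp: the_inv_into_f_f intro!: comp_inj_on)
    finally have ls: "relabel F ?U ?l s = rep ?n d" using relabel_id[OF fin rd] by simp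
    have lv: "inj_on (?l \<circ> ?v) (base ?n)" "(?l \<circ> ?v) ` base ?n = base ?n"
    proof -
      show "inj_on (?l \<circ> ?v) (base ?n)" by (rule comp_inj_on[OF v(1)]) (simp only: v(2) l(1))
      show "(?l \<circ> ?v) ` base ?n = base ?n" using v(2) l(2) by (metis image_comp)
    qed
    have ls2: "relabel F ?U ?l s = relabel F (base ?n) (?l \<circ> ?v) (rep ?n b)"
      using relabel_comp[OF fin v(1) _ rb, of ?l] v l sv by simp
    define q where "q a = (if a \<in> base ?n then (?l \<circ> ?v) a else a)" for a
    have "bij_betw q (base ?n) (base ?n)"
      using lv by (subst bij_betw_cong[of _ _ "?l \<circ> ?v"]) (auto simp: q_def bij_betw_def)
    then have q: "q permutes base ?n" by (rule bij_imp_permutes) (simp add: q_def)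
    have "relabel F (base ?n) (?l \<circ> ?v) (rep ?n b) = relabel F (base ?n) q (rep ?n b)"
      by (intro relabel_cong[OF fin lv(1) rb]) (simp add: q_def)
    then have "same ?n (rep ?n b) (rep ?n d)" using q ls ls2 unfolding same_def by metis
    then have "same ?n b d"
      using rep[OF b] rep[OF d] same_trans same_sym b rb rd by metis
    then have bd: "rep ?n b = rep ?n d" using rep_eq b by blast
    have "?v 0 = add_point_map k 0"
      by (rule relabel_inj[OF fin v(1) kp(1) _ rb])
        (use v kp sv s bd in \<open>auto simp: base_def\<close>)
    then have "(c ?U ^^ i) 0 = 0" by simp
    then have "c ?U ^^ i = id" using pow_fix_imp_id[OF U(1) zero_in_add_point] by blast
    then show "r = s" using i relabel_id[OF U(1) subsetD[OF R_sub rR]] by simp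
  qed
  have stable: "relabel F (add_point S) (add_point_map \<sigma>) r \<in> R (\<sigma> ` S)"
    if S: "finite S" and \<sigma>: "inj_on \<sigma> S" and r: "r \<in> R S" for S \<sigma> r
  proof -
    obtain h b where h: "bij_betw h {..<card S} S" and b: "b \<in> structures F (base (card S))"
      and r: "r = relabel F (base (card S)) (add_point_map h) (rep (card S) b)"
      using r unfolding R_def by blast
    have "relabel F (add_point S) (add_point_map \<sigma>) r =
        relabel F (base (card S)) (add_point_map (\<sigma> \<circ> h)) (rep (card S) b)"
      using relabel_comp[OF fin h_props(1)[OF h], of "add_point_map \<sigma>" "rep (card S) b"]
        rep[OF b] inj_on_add_point_map[OF \<sigma>]
      by (simp add: h_props(2)[OF h] r add_point_map_comp)
    moreover have "bij_betw (\<sigma> \<circ> h) {..<card S} (\<sigma> ` S)"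
      using h \<sigma> by (metis bij_betw_trans inj_on_imp_bij_betw)
    moreover have "card (\<sigma> ` S) = card S" using \<sigma> by (rule card_image)
    ultimately show ?thesis unfolding R_def using b by auto
  qed
  have "orbit_section c F R"
    unfolding orbit_section_def
  proof (intro allI impI conjI ballI)
    fix S :: "nat set" and x assume "finite S" "x \<in> structures F (add_point S)"
    then show "\<exists>!r. r \<in> R S \<and> r \<in> orb (add_point S) x"
      using ex[of S x] uniq[of S x] by (intro ex_ex1I) simp_all
  qed (use R_sub stable in simp_all)
  then show ?thesis by (rule exI[of "orbit_section c F"])
qed

theorem regular_X_op: "regular_structure_type (X_op c F)"
proof -
  define R where "R = (SOME R. orbit_section c F R)"
  have sec: "orbit_section c F R" unfolding R_def using orbit_section_exists by (rule someI_ex)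
  define pick where "pick S B = (THE r. r \<in> R S \<and> r \<in> B)" for S B
  have str: "structures (X_op c F) S = orb (add_point S) ` structures F (add_point S)"
    if "finite S" for S
    using that by (simp add: X_op_def degree_part_def card_add_point Let_def)
  have rel: "relabel (X_op c F) S \<sigma> B =
      orb (add_point (\<sigma> ` S)) (relabel F (add_point S) (add_point_map \<sigma>) (pick S B))" for S \<sigma> B
    by (simp add: X_op_def Let_def R_def pick_def)
  have R_in: "r \<in> structures F (add_point S)" if "finite S" "r \<in> R S" for S r
    using orbit_sectionD(1)[OF sec that(1)] that(2) by blast
  have pick: "pick S B \<in> R S" "pick S B \<in> structures F (add_point S)" "B = orb (add_point S) (pick S B)"
    if S: "finite S" and B: "B \<in> structures (X_op c F) S" for S B
  proof -
    obtain x where x: "x \<in> structures F (add_point S)" "B = orb (add_point S) x"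
      using B str[OF S] by blast
    have "\<exists>!r. r \<in> R S \<and> r \<in> B" using orbit_sectionD(2)[OF sec S x(1)] x(2) by simp
    then have "pick S B \<in> R S \<and> pick S B \<in> B" unfolding pick_def by (rule theI')
    then have p: "pick S B \<in> R S" "pick S B \<in> B" by blast+
    show "pick S B \<in> R S" by (rule p)
    then show "pick S B \<in> structures F (add_point S)" using R_in S by blast
    show "B = orb (add_point S) (pick S B)"
      using orb_eq[OF finite_add_point[OF S] add_point_ne x(1)] p x(2) by blast
  qed
  have pick_orb: "pick S (orb (add_point S) r) = r" if S: "finite S" and r: "r \<in> R S" for S r
  proof -
    have "r \<in> orb (add_point S) r" using orb_self R_in S r by simp
    moreover have "\<exists>!s. s \<in> R S \<and> s \<in> orb (add_point S) r"
      by (rule orbit_sectionD(2)[OF sec S R_in[OF S r]])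
    ultimately show ?thesis unfolding pick_def using r by (intro the1_equality) simp_all
  qed
  have stable: "relabel F (add_point S) (add_point_map \<sigma>) r \<in> R (\<sigma> ` S)"
    if "finite S" "inj_on \<sigma> S" "r \<in> R S" for S \<sigma> r
    by (rule orbit_sectionD(3)[OF sec that])
  show ?thesis
  proof unfold_locales
    fix S :: "nat set" assume S: "finite S"
    show "finite (structures (X_op c F) S)"
      using finite_structures[of "add_point S"] S by (simp add: str)
  next
    fix S :: "nat set" and \<sigma> :: "nat \<Rightarrow> nat" and B
    assume S: "finite S" and \<sigma>: "inj_on \<sigma> S" and B: "B \<in> structures (X_op c F) S"
    show "relabel (X_op c F) S \<sigma> B \<in> structures (X_op c F) (\<sigma> ` S)"
      using R_in[OF _ stable[OF S \<sigma> pick(1)[OF S B]]] S by (simp add: rel str)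
  next
    fix S :: "nat set" and \<sigma> \<tau> :: "nat \<Rightarrow> nat" and B
    assume S: "finite S" and \<sigma>: "inj_on \<sigma> S" and B: "B \<in> structures (X_op c F) S"
      and eq: "\<forall>s\<in>S. \<sigma> s = \<tau> s"
    have "\<sigma> ` S = \<tau> ` S" using eq by (simp cong: image_cong)
    moreover have "relabel F (add_point S) (add_point_map \<sigma>) (pick S B) =
        relabel F (add_point S) (add_point_map \<tau>) (pick S B)"
      using S \<sigma> eq pick(2)[OF S B]
      by (intro relabel_cong) (auto simp: inj_on_add_point_map, auto simp: add_point_def)
    ultimately show "relabel (X_op c F) S \<sigma> B = relabel (X_op c F) S \<tau> B" by (simp add: rel)
  next
    fix S :: "nat set" and B
    assume S: "finite S" and B: "B \<in> structures (X_op c F) S"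
    show "relabel (X_op c F) S id B = B"
      using pick(2,3)[OF S B] S by (simp add: rel relabel_id)
  next
    fix S :: "nat set" and \<sigma> \<tau> :: "nat \<Rightarrow> nat" and B
    assume S: "finite S" and \<sigma>: "inj_on \<sigma> S" and \<tau>: "inj_on \<tau> (\<sigma> ` S)"
      and B: "B \<in> structures (X_op c F) S"
    let ?r = "relabel F (add_point S) (add_point_map \<sigma>) (pick S B)"
    have "pick (\<sigma> ` S) (orb (add_point (\<sigma> ` S)) ?r) = ?r"
      using pick_orb stable[OF S \<sigma> pick(1)[OF S B]] S by simp
    moreover have "relabel F (add_point (\<sigma> ` S)) (add_point_map \<tau>) ?r =
        relabel F (add_point S) (add_point_map (\<tau> \<circ> \<sigma>)) (pick S B)"
      using relabel_comp[of "add_point S" "add_point_map \<sigma>" "add_point_map \<tau>" "pick S B"]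
        S inj_on_add_point_map[OF \<sigma>] inj_on_add_point_map[OF \<tau>] pick(2)[OF S B]
      by (simp add: add_point_map_image add_point_map_comp)
    ultimately show "relabel (X_op c F) (\<sigma> ` S) \<tau> (relabel (X_op c F) S \<sigma> B) =
        relabel (X_op c F) S (\<tau> \<circ> \<sigma>) B"
      by (simp add: rel image_comp)
  next
    fix S :: "nat set" and B \<sigma>
    assume S: "finite S" and B: "B \<in> structures (X_op c F) S" and \<sigma>: "\<sigma> permutes S"
      and eq: "relabel (X_op c F) S \<sigma> B = B"
    let ?r = "relabel F (add_point S) (add_point_map \<sigma>) (pick S B)"
    have "?r \<in> R S"
      using stable[OF S permutes_inj_on[OF \<sigma>] pick(1)[OF S B]] permutes_image[OF \<sigma>] by simp
    then have "pick S (orb (add_point S) ?r) = ?r" by (rule pick_orb[OF S])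
    moreover have "orb (add_point S) ?r = B" using eq permutes_image[OF \<sigma>] by (simp add: rel)
    ultimately have "?r = pick S B" by simp
    then have "add_point_map \<sigma> = id"
      using trivial_stabilizer[of "add_point S" "pick S B"] S pick(2)[OF S B]
        add_point_map_permutes[OF \<sigma>] by simp
    then show "\<sigma> = id" by (rule add_point_map_eq_idD)
  qed
qed

end

lemma regular_V_op:
  assumes c: "cycle_choice c" and \<Phi>: "regular_integral \<Phi>"
  shows "regular_integral (V_op c \<Phi>)"
proof -
  have X: "regular_structure_type (X_op c (degree_part k F))"
    if "regular_structure_type F" for F :: "'x structure_data" and k
    using regular_with_cycles.regular_X_op[of "degree_part k F" c]
      regular_structure_type.regular_degree_part[OF that] c
    by (simp add: regular_with_cycles_def regular_with_cycles_axioms_def)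
  have emp: "structures (X_op c (degree_part k F)) S = {}" if "finite S" "k \<noteq> card S + 1"
    for F :: "'x structure_data" and k S
    using that by (simp add: X_op_def Let_def degree_part_def card_add_point)
  have main: "regular_structure_type (sum_structure
      (\<lambda>k. if k = 0 \<or> k = 1 then zero_structure else X_op c (degree_part k F)))" (is "regular_structure_type (sum_structure ?G)")
    if F: "regular_structure_type F" for F :: "'x structure_data"
  proof (rule regular_sum_structure)
    fix k show "regular_structure_type (?G k)"
      using X[OF F] regular_zero_structure by auto
  next
    fix S :: "nat set" assume "finite S"
    then have "{k. structures (?G k) S \<noteq> {}} \<subseteq> {card S + 1}"
      using emp by (auto simp: zero_structure_def split: if_splits)
    then show "finite {k. structures (?G k) S \<noteq> {}}" by (rule finite_subset) simp
  qed
  show ?thesis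
    using main[of "fst \<Phi>"] main[of "snd \<Phi>"] \<Phi>
    unfolding regular_integral_def V_op_def integral_sum_def V_homogeneous_def integral_degree_part_def
    by (simp add: if_distrib[of fst] if_distrib[of snd] cong: if_cong)
qed

end

theory Submission
  imports Defs "HOL-Algebra.Group_Action" "HOL-Algebra.Multiplicative_Group"
begin

text \<open>
  A group of permutations of \<open>U\<close> acts freely on the structures \<open>F(U)\<close> of a regular \<open>F\<close>, so its order
  times the number of its orbits is \<open>|F(U)|\<close>.  For the full symmetric group this shows that
  \<open>F\<^sub>n / n!\<close> counts isomorphism classes and is therefore an integer.  For the cyclic group
  of order \<open>n + 1\<close> it gives \<open>(n + 1) (\<X>F)\<^sub>n = F\<^sub>n\<^sub>+\<^sub>1\<close>, that is
  \<open>(\<X>F)\<^sub>n / n! = F\<^sub>n\<^sub>+\<^sub>1 / (n + 1)!\<close>: the operator \<open>\<X>\<close> shifts the generating series by one place.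
\<close>

section \<open>Free actions and groups of permutations\<close>

locale free_action = group_action +
  assumes stabilizer_eq_one: "x \<in> E \<Longrightarrow> stabilizer G \<phi> x = {\<one>}"
begin

lemma order_times_card_orbits:
  assumes "finite E"
  shows "order G * card (orbits G E \<phi>) = card E"
proof -
  have card_orbit: "card Q = order G" if "Q \<in> orbits G E \<phi>" for Q
    using that orbit_stabilizer_theorem stabilizer_eq_one by (fastforce simp: orbits_def)
  have "card E = (\<Sum>Q\<in>orbits G E \<phi>. card Q)"
    using disjoint_sum[OF assms, of "\<lambda>_. 1 :: nat"] by simp
  also have "\<dots> = order G * card (orbits G E \<phi>)"
    by (simp add: card_orbit)
  finally show ?thesis ..
qed

lemma free_action_subgroup:
  assumes "subgroup H G"
  shows "free_action (G\<lparr>carrier := H\<rparr>) E \<phi>"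
proof (intro free_action.intro induced_action free_action_axioms.intro assms)
  fix x assume "x \<in> E"
  moreover have "stabilizer (G\<lparr>carrier := H\<rparr>) \<phi> x = H \<inter> stabilizer G \<phi> x"
    using subgroup.subset[OF assms] by (auto simp: stabilizer_def)
  ultimately show "stabilizer (G\<lparr>carrier := H\<rparr>) \<phi> x = {\<one>\<^bsub>G\<lparr>carrier := H\<rparr>\<^esub>}"
    using stabilizer_eq_one subgroup.one_closed[OF assms] by simp
qed

end

definition permutation_group :: "'a set \<Rightarrow> ('a \<Rightarrow> 'a) monoid" where
  "permutation_group U = \<lparr>carrier = {p. p permutes U}, mult = (\<circ>), one = id\<rparr>"

lemma permutation_group_simps [simp]:
  "p \<in> carrier (permutation_group U) \<longleftrightarrow> p permutes U"
  "p \<otimes>\<^bsub>permutation_group U\<^esub> q = p \<circ> q"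
  "\<one>\<^bsub>permutation_group U\<^esub> = id"
  by (simp_all add: permutation_group_def)

lemma group_permutation_group: "group (permutation_group U)"
proof (rule groupI)
  fix p assume "p \<in> carrier (permutation_group U)"
  then have "Hilbert_Choice.inv p permutes U" and "Hilbert_Choice.inv p \<circ> p = id"
    by (simp_all add: permutes_inv permutes_inv_o)
  then show "\<exists>q\<in>carrier (permutation_group U).
      q \<otimes>\<^bsub>permutation_group U\<^esub> p = \<one>\<^bsub>permutation_group U\<^esub>"
    by (intro bexI[of _ "Hilbert_Choice.inv p"]) simp_all
qed (simp_all add: permutes_compose comp_assoc)

lemma order_permutation_group: "finite U \<Longrightarrow> order (permutation_group U) = fact (card U)"
  by (simp add: order_def permutation_group_def card_permutations)

lemma nat_pow_permutation_group: "p [^]\<^bsub>permutation_group U\<^esub> (n :: nat) = p ^^ n"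
proof (induction n)
  case (Suc n)
  then show ?case by (simp add: funpow_Suc_right del: funpow.simps)
qed simp

lemma generate_permutation_group:
  assumes "finite U" and "p permutes U"
  shows "generate (permutation_group U) {p} = range (\<lambda>i. p ^^ i)"
proof -
  have "finite (carrier (permutation_group U))"
    using assms(1) by (simp add: permutation_group_def finite_permutations)
  then show ?thesis
    using group.generate_pow_on_finite_carrier[OF group_permutation_group, of U p] assms(2)
    by (auto simp: nat_pow_permutation_group)
qed

lemma cyclic_on_obtain_funpow:
  assumes "cyclic_on f U" and "u \<in> U" and "v \<in> U"
  obtains k where "(f ^^ k) u = v"
proof -
  have "v \<in> Orbits.orbit f u"
    using assms by (simp add: cyclic_on_alldef)
  then show ?thesis using that by (auto simp: Orbits.orbit_altdef)
qed

lemma cyclic_on_funpow_eqI: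
  assumes permutes: "f permutes U" and cyclic: "cyclic_on f U"
    and "u \<in> U" and agree: "(f ^^ i) u = (f ^^ j) u"
  shows "f ^^ i = f ^^ j"
proof
  fix v
  show "(f ^^ i) v = (f ^^ j) v"
  proof (cases "v \<in> U")
    case True
    then obtain k where v_eq: "v = (f ^^ k) u"
      using cyclic_on_obtain_funpow[OF cyclic \<open>u \<in> U\<close>] by metis
    have "(f ^^ i) v = (f ^^ k) ((f ^^ i) u)"
      unfolding v_eq by (metis add.commute comp_apply funpow_add)
    also have "\<dots> = (f ^^ j) v"
      unfolding v_eq agree by (metis add.commute comp_apply funpow_add)
    finally show ?thesis .
  next
    case False
    then have "(f ^^ n) v = v" for n
      using permutes by (induction n) (simp_all add: permutes_not_in)
    then show ?thesis by simp
  qed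
qed

lemma card_range_funpow_cyclic_on:
  assumes "f permutes U" and "cyclic_on f U"
  shows "card (range (\<lambda>i. f ^^ i)) = card U"
proof -
  obtain u where "u \<in> U"
    using assms(2) by (auto simp: cyclic_on_def)
  have "inj_on (\<lambda>p. p u) (range (\<lambda>i. f ^^ i))"
    using cyclic_on_funpow_eqI[OF assms \<open>u \<in> U\<close>] by (auto simp: inj_on_def)
  then have "card (range (\<lambda>i. f ^^ i)) = card ((\<lambda>p. p u) ` range (\<lambda>i. f ^^ i))"
    by (simp add: card_image)
  also have "(\<lambda>p. p u) ` range (\<lambda>i. f ^^ i) = U"
  proof
    show "(\<lambda>p. p u) ` range (\<lambda>i. f ^^ i) \<subseteq> U"
      using cyclic_on_funpow_in[OF assms(2) \<open>u \<in> U\<close>] by auto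
    show "U \<subseteq> (\<lambda>p. p u) ` range (\<lambda>i. f ^^ i)"
      by (blast elim: cyclic_on_obtain_funpow[OF assms(2) \<open>u \<in> U\<close>])
  qed
  finally show ?thesis .
qed

section \<open>Counting structures up to relabelling\<close>

context structure_type
begin

lemma relabel_compose_permutations:
  assumes "finite U" and "p permutes U" and "q permutes U" and "x \<in> structures F U"
  shows "relabel F U q (relabel F U p x) = relabel F U (q \<circ> p) x"
  using relabel_comp[of U p q x] assms by (simp add: permutes_inj_on permutes_image)

lemma relabel_permutation_image_subset:
  assumes "finite U" and "p permutes U"
  shows "relabel F U p ` structures F U \<subseteq> structures F U"
  using relabel_in[of U p] assms by (auto simp: permutes_inj_on permutes_image)

lemma bij_betw_relabel_permutation:
  assumes "finite U" and "p permutes U"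
  shows "bij_betw (relabel F U p) (structures F U) (structures F U)"
  using assms permutes_inv[OF assms(2)]
  by (intro bij_betw_byWitness[where f' = "relabel F U (Hilbert_Choice.inv p)"])
    (simp_all add: relabel_compose_permutations relabel_permutation_image_subset
      permutes_inv_o relabel_id)

definition relabel_action :: "nat set \<Rightarrow> (nat \<Rightarrow> nat) \<Rightarrow> 'a \<Rightarrow> 'a" where
  "relabel_action U p = restrict (relabel F U p) (structures F U)"

lemma group_action_relabel_action:
  assumes "finite U"
  shows "group_action (permutation_group U) (structures F U) (relabel_action U)"
proof -
  have relabel_Bij: "relabel_action U p \<in> Bij (structures F U)" if "p permutes U" for p
    using bij_betw_relabel_permutation[OF assms that]
    by (simp add: Bij_def relabel_action_def)
  have relabel_comp_Bij: "relabel_action U (q \<circ> p) =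
      compose (structures F U) (relabel_action U q) (relabel_action U p)"
    if "p permutes U" "q permutes U" for p q
    using bij_betw_relabel_permutation[OF assms that(1)] relabel_compose_permutations[OF assms that]
    by (auto simp: compose_def relabel_action_def restrict_def fun_eq_iff bij_betw_def)
  have "relabel_action U \<in> hom (permutation_group U) (BijGroup (structures F U))"
    by (auto simp: hom_def permutation_group_def BijGroup_def relabel_Bij relabel_comp_Bij)
  then show ?thesis
    by (simp add: group_action_def group_hom_def group_hom_axioms_def
        group_permutation_group group_BijGroup)
qed

definition isomorphism_classes :: "nat set \<Rightarrow> 'a set set" where
  "isomorphism_classes U = orbits (permutation_group U) (structures F U) (relabel_action U)"

end

context regular_structure_type
begin

lemma free_action_relabel_action:
  assumes "finite U"
  shows "free_action (permutation_group U) (structures F U) (relabel_action U)"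
proof (intro free_action.intro group_action_relabel_action free_action_axioms.intro assms)
  fix x assume "x \<in> structures F U"
  then show "stabilizer (permutation_group U) (relabel_action U) x = {\<one>\<^bsub>permutation_group U\<^esub>}"
    using trivial_stabilizer[OF assms] relabel_id[OF assms]
    by (auto simp: stabilizer_def permutation_group_def relabel_action_def)
qed

lemma fact_times_card_isomorphism_classes:
  assumes "finite U"
  shows "fact (card U) * card (isomorphism_classes U) = card (structures F U)"
  using free_action.order_times_card_orbits[OF free_action_relabel_action[OF assms]] assms
  by (simp add: order_permutation_group finite_structures isomorphism_classes_def)

lemma generating_series_eq_card_isomorphism_classes:
  "generating_series F = fps_of_int_fps (Abs_fps (\<lambda>n. int (card (isomorphism_classes {..<n}))))"
proof (rule fps_ext)
  fix n
  have "card (structures F {..<n}) = fact n * card (isomorphism_classes {..<n})"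
    using fact_times_card_isomorphism_classes[of "{..<n}"] by simp
  then show "fps_nth (generating_series F) n =
      fps_nth (fps_of_int_fps (Abs_fps (\<lambda>n. int (card (isomorphism_classes {..<n}))))) n"
    by (simp add: generating_series_def fps_of_int_fps_def)
qed

end

context regular_with_cycles
begin

lemma card_times_card_cyc_orbits:
  assumes U: "finite U" "U \<noteq> {}"
  shows "card U * card (orb U ` structures F U) = card (structures F U)"
proof -
  let ?S = "permutation_group U" and ?C = "generate (permutation_group U) {c U}"
  have cycle: "c U permutes U" "cyclic_on (c U) U"
    using cycles U by (auto simp: cycle_choice_def)
  have cyclic_group_eq: "?C = range (\<lambda>i. c U ^^ i)"
    using generate_permutation_group[OF U(1) cycle(1)] .
  have "subgroup ?C ?S"
    using cycle(1) by (intro group.generate_is_subgroup group_permutation_group) simp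
  then interpret free_action "?S\<lparr>carrier := ?C\<rparr>" "structures F U" "relabel_action U"
    using free_action.free_action_subgroup[OF free_action_relabel_action[OF U(1)]] by simp
  have "order (?S\<lparr>carrier := ?C\<rparr>) = card U"
    using card_range_funpow_cyclic_on[OF cycle] by (simp add: order_def cyclic_group_eq)
  moreover have "orbit (?S\<lparr>carrier := ?C\<rparr>) (relabel_action U) x = orb U x"
    if "x \<in> structures F U" for x
    using that by (auto simp: orbit_def cyc_orbit_def cyclic_group_eq relabel_action_def)
  then have "orbits (?S\<lparr>carrier := ?C\<rparr>) (structures F U) (relabel_action U) =
      orb U ` structures F U"
    by (auto simp: orbits_def)
  ultimately show ?thesis
    using order_times_card_orbits finite_structures[OF U(1)] by simp
qed

lemma card_structures_X_op:
  assumes "finite S"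
  shows "Suc (card S) * card (structures (X_op c F) S) = card (structures F {..<Suc (card S)})"
  using card_times_card_cyc_orbits[of "add_point S"] card_structures[of "add_point S"] assms
  by (simp add: X_op_def Let_def degree_part_def card_add_point)

end

section \<open>Generating series\<close>

lemma (in regular_with_cycles) generating_series_X_op:
  "generating_series (X_op c F) = fps_shift 1 (generating_series F)"
proof (rule fps_ext)
  fix n
  have "card (structures F {..<Suc n}) = Suc n * card (structures (X_op c F) {..<n})"
    using card_structures_X_op[of "{..<n}"] by simp
  then have "(of_nat (card (structures F {..<Suc n})) :: rat) =
      of_nat (Suc n) * of_nat (card (structures (X_op c F) {..<n}))"
    by (simp only: of_nat_mult)
  then show "fps_nth (generating_series (X_op c F)) n = fps_nth (fps_shift 1 (generating_series F)) n"
    by (simp add: generating_series_def del: of_nat_Suc)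
qed

lemma generating_series_zero_structure: "generating_series zero_structure = 0"
  by (rule fps_ext) (simp add: generating_series_def zero_structure_def)

lemma generating_series_nth_degree_part:
  "fps_nth (generating_series (degree_part k F)) n =
    (if n = k then fps_nth (generating_series F) n else 0)"
  by (simp add: generating_series_def degree_part_def)

lemma generating_series_nth_sum_structure:
  assumes structure_type: "\<And>k. structure_type (G k)" and "finite K"
    and vanishes: "\<And>k. k \<notin> K \<Longrightarrow> fps_nth (generating_series (G k)) n = 0"
  shows "fps_nth (generating_series (sum_structure G)) n =
    (\<Sum>k\<in>K. fps_nth (generating_series (G k)) n)"
proof -
  have finite_summand: "finite (structures (G k) {..<n})" for k
    using structure_type.finite_structures[OF structure_type] by simp
  have "structures (G k) {..<n} = {}" if "k \<notin> K" for k
    using vanishes[OF that] finite_summand by (simp add: generating_series_def)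
  then have "structures (sum_structure G) {..<n} = (SIGMA k:K. structures (G k) {..<n})"
    by (auto simp: sum_structure_def)
  then show ?thesis
    using \<open>finite K\<close> finite_summand by (simp add: generating_series_def sum_divide_distrib)
qed

definition homogeneous_X_op ::
    "(nat set \<Rightarrow> nat \<Rightarrow> nat) \<Rightarrow> nat \<Rightarrow> 'a structure_data \<Rightarrow> 'a set structure_data" where
  "homogeneous_X_op c k F = (if k = 0 \<or> k = 1 then zero_structure else X_op c F)"

definition graded_X_op ::
    "(nat set \<Rightarrow> nat \<Rightarrow> nat) \<Rightarrow> 'a structure_data \<Rightarrow> (nat \<times> 'a set) structure_data" where
  "graded_X_op c F = sum_structure (\<lambda>k. homogeneous_X_op c k (degree_part k F))"

context regular_with_cycles
begin

lemma regular_with_cycles_degree_part: "regular_with_cycles (degree_part k F) c"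
  by (intro regular_with_cycles.intro regular_degree_part regular_with_cycles_axioms.intro cycles)

lemma regular_homogeneous_X_op: "regular_structure_type (homogeneous_X_op c k F)"
  by (simp add: homogeneous_X_op_def regular_X_op regular_zero_structure)

lemma generating_series_homogeneous_X_op:
  "generating_series (homogeneous_X_op c k F) =
    (if k = 0 \<or> k = 1 then 0 else fps_shift 1 (generating_series F))"
  by (simp add: homogeneous_X_op_def generating_series_X_op generating_series_zero_structure)

lemma generating_series_graded_X_op:
  "generating_series (graded_X_op c F) =
    fps_shift 1 (generating_series F) - fps_const (fps_nth (generating_series F) 1)"
proof (rule fps_ext)
  fix n
  let ?G = "\<lambda>k. homogeneous_X_op c k (degree_part k F)"
  have "structure_type (?G k)" for k
    using regular_with_cycles_degree_part
    by (intro regular_structure_type.axioms(1) regular_with_cycles.regular_homogeneous_X_op)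
  moreover have summand: "fps_nth (generating_series (?G k)) n =
      (if k = Suc n \<and> n \<noteq> 0 then fps_nth (generating_series F) (Suc n) else 0)" for k
    using regular_with_cycles.generating_series_homogeneous_X_op[OF regular_with_cycles_degree_part]
    by (simp add: generating_series_nth_degree_part)
  ultimately have "fps_nth (generating_series (graded_X_op c F)) n =
      (\<Sum>k\<in>{Suc n}. fps_nth (generating_series (?G k)) n)"
    unfolding graded_X_op_def by (intro generating_series_nth_sum_structure) simp_all
  then show "fps_nth (generating_series (graded_X_op c F)) n =
      fps_nth (fps_shift 1 (generating_series F) - fps_const (fps_nth (generating_series F) 1)) n"
    by (simp add: summand)
qed

end

lemma V_op_eq_graded_X_op: "V_op c \<Phi> = (graded_X_op c (snd \<Phi>), graded_X_op c (fst \<Phi>))"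
  by (simp add: V_op_def integral_sum_def V_homogeneous_def integral_degree_part_def
      graded_X_op_def homogeneous_X_op_def if_distrib[of fst] if_distrib[of snd] cong: if_cong)

lemma integral_series_V_op:
  assumes "cycle_choice c" and "regular_integral \<Phi>"
  shows "integral_series (V_op c \<Phi>) =
    fps_const (fps_nth (integral_series \<Phi>) 1) - fps_shift 1 (integral_series \<Phi>)"
proof -
  have "regular_with_cycles (fst \<Phi>) c" "regular_with_cycles (snd \<Phi>) c"
    using assms
    by (simp_all add: regular_integral_def regular_with_cycles_def regular_with_cycles_axioms_def)
  then show ?thesis
    by (intro fps_ext)
      (simp add: integral_series_def V_op_eq_graded_X_op
        regular_with_cycles.generating_series_graded_X_op)
qed

lemma fps_of_int_fps_diff: "fps_of_int_fps (a - b) = fps_of_int_fps a - fps_of_int_fps b"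
  by (rule fps_ext) (simp add: fps_of_int_fps_def)

lemma fps_of_int_fps_vartheta:
  "fps_of_int_fps (vartheta a) =
    fps_const (fps_nth (fps_of_int_fps a) 1) - fps_shift 1 (fps_of_int_fps a)"
  by (rule fps_ext) (simp add: fps_of_int_fps_def vartheta_def)

lemma regular_integral_series_is_int:
  assumes "regular_integral \<Phi>"
  obtains a where "integral_series \<Phi> = fps_of_int_fps a"
proof -
  have "regular_structure_type (fst \<Phi>)" and "regular_structure_type (snd \<Phi>)"
    using assms by (simp_all add: regular_integral_def)
  note series = this[THEN regular_structure_type.generating_series_eq_card_isomorphism_classes]
  show ?thesis
    by (rule that) (simp only: integral_series_def series flip: fps_of_int_fps_diff)
qed

theorem theorem7p1:
  fixes \<Phi> :: "('a, 'b) integral_data" and c :: "nat set \<Rightarrow> nat \<Rightarrow> nat"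
  assumes "cycle_choice c" and "regular_integral \<Phi>"
  shows "\<exists>a :: int fps. integral_series \<Phi> = fps_of_int_fps a \<and>
    integral_series (V_op c \<Phi>) = fps_of_int_fps (vartheta a)"
proof -
  obtain a where series_eq: "integral_series \<Phi> = fps_of_int_fps a"
    using regular_integral_series_is_int[OF assms(2)] .
  have "integral_series (V_op c \<Phi>) =
      fps_const (fps_nth (integral_series \<Phi>) 1) - fps_shift 1 (integral_series \<Phi>)"
    using assms by (rule integral_series_V_op)
  also have "\<dots> = fps_of_int_fps (vartheta a)"
    by (simp only: series_eq fps_of_int_fps_vartheta)
  finally show ?thesis using series_eq by blast
qed

end
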